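(* Let $I=[0,\gamma)$ with $0<\gamma\le\infty$, let $w$ be a weight function on $I$ with $W(t)=\int_0^t w$, and let $\varphi:[0,\infty)\to[0,\infty]$ be a convex, left-continuous function with $\varphi(0)=0$, $\varphi(\infty)=\infty$, not identically zero on $[0,\infty)$ (and not identically $\infty$ on $(0,\infty)$). Then the fundamental function $\phi_{\mathcal{M}_{\varphi,w}}(t)=\|\chi_{(0,t)}\|_{\mathcal{M}_{\varphi,w}}$, $t\in(0,\gamma)$, of the space $\mathcal{M}_{\varphi,w}$ equipped with the Luxemburg norm is expressed by $$\phi_{\mathcal{M}_{\varphi,w}}(t)=\frac{t/W(t)}{\varphi^{-1}(1/W(t))},$$ where $\varphi^{-1}$ is the inverse function of $\varphi$ restricted to the interval $(a_\varphi,b_\varphi]$. In the case $b_\varphi=\infty$, this inverse function is defined with respect to $\varphi$ restricted to the interval $(a_\varphi,\infty)$.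
   Context: A weight function is a decreasing (i.e. non-increasing), positive, locally integrable function $w$ on $I=[0,\gamma)$ with $W(t)=\int_0^t w<\infty$ for $t\in[0,\gamma)$; if $\gamma=\infty$ it is assumed that $\int_0^\infty w=\infty$. $L_0$ is the space of (classes of) Lebesgue measurable functions on $I$; $m$ is Lebesgue measure. For $f\in L_0$, $d_f(\lambda)=m\{t:|f(t)|>\lambda\}$ and $f^*(t)=\inf\{\lambda>0:d_f(\lambda)\le t\}$ is the decreasing rearrangement. $v\prec w$ means $\int_0^t v^*\le\int_0^t w^*$ for all $t>0$. Constants: $a_\varphi=\sup\{u>0:\varphi(u)=0\}$ ($=0$ if the set is empty), $b_\varphi=\sup\{u\ge 0:\varphi(u)<\infty\}$. The modular is $$P_{\varphi,w}(f)=\inf\left\{\int_I\varphi\left(\frac{f^*}{v}\right)v:\ v\prec w,\ v>0,\ v\downarrow\right\},$$ $\mathcal{M}_{\varphi,w}=\{f\in L_0:P_{\varphi,w}(kf)<\infty\text{ for some }k>0\}$, and its Luxemburg norm is $\|f\|_{\mathcal{M}_{\varphi,w}}=\inf\{\epsilon>0:P_{\varphi,w}(f/\epsilon)\le 1\}$.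
   Formalization: When b_φ is finite and 1/W(t) is not a value of φ on (a_φ,b_φ] (that is, 1/W(t) > φ(b_φ), including a_φ = b_φ), the inverse in the formula is undefined; there φ^{-1}(1/W(t)) is taken to be b_φ, and the formula holds for every t in (0,γ). *)

theory Defs
  imports "HOL-Analysis.Analysis"
begin

definition dom_I :: "ereal \<Rightarrow> real set" where
  "dom_I \<gamma> = {t. 0 \<le> t \<and> ereal t < \<gamma>}"

definition distribution_fun :: "ereal \<Rightarrow> (real \<Rightarrow> real) \<Rightarrow> real \<Rightarrow> ennreal" where
  "distribution_fun \<gamma> f r = emeasure lebesgue {t \<in> dom_I \<gamma>. r < \<bar>f t\<bar>}"

(* Only used at t >= 0; the value may be infinite (Inf {} = top). *)
definition rearrangement :: "ereal \<Rightarrow> (real \<Rightarrow> real) \<Rightarrow> real \<Rightarrow> ennreal" where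
  "rearrangement \<gamma> f t =
     Inf {ennreal r | r. 0 < r \<and> distribution_fun \<gamma> f r \<le> ennreal t}"

definition majorized :: "ereal \<Rightarrow> (real \<Rightarrow> real) \<Rightarrow> (real \<Rightarrow> real) \<Rightarrow> bool" where
  "majorized \<gamma> v w \<longleftrightarrow>
     (\<forall>t>0. (\<integral>\<^sup>+s\<in>{0<..<t}. rearrangement \<gamma> v s \<partial>lebesgue)
          \<le> (\<integral>\<^sup>+s\<in>{0<..<t}. rearrangement \<gamma> w s \<partial>lebesgue))"

definition primitive :: "(real \<Rightarrow> real) \<Rightarrow> real \<Rightarrow> ennreal" where
  "primitive w t = (\<integral>\<^sup>+s\<in>{0<..<t}. ennreal (w s) \<partial>lebesgue)"

(* The value at the point 0 is left free: a real-valued function that is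
   decreasing on all of [0,gamma) would be bounded, which would exclude
   weights such as 1 / sqrt t. *)
definition pos_decreasing :: "ereal \<Rightarrow> (real \<Rightarrow> real) \<Rightarrow> bool" where
  "pos_decreasing \<gamma> v \<longleftrightarrow>
     (\<forall>t \<in> dom_I \<gamma> - {0}. 0 < v t) \<and> antimono_on (dom_I \<gamma> - {0}) v"

definition weight_function :: "ereal \<Rightarrow> (real \<Rightarrow> real) \<Rightarrow> bool" where
  "weight_function \<gamma> w \<longleftrightarrow>
     pos_decreasing \<gamma> w \<and>
     (\<forall>t \<in> dom_I \<gamma>. set_integrable lebesgue {0..t} w) \<and>
     (\<forall>t \<in> dom_I \<gamma>. primitive w t < \<infinity>) \<and>
     (\<gamma> = \<infinity> \<longrightarrow> (\<integral>\<^sup>+s\<in>dom_I \<gamma>. ennreal (w s) \<partial>lebesgue) = \<infinity>)"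

(* The argument of phi is extended to the point infinity because the
   rearrangement of a finite function can be infinite; convexity and left
   continuity are conditions on [0,infinity) only. *)
definition young_function :: "(ennreal \<Rightarrow> ennreal) \<Rightarrow> bool" where
  "young_function \<phi> \<longleftrightarrow>
     \<phi> 0 = 0 \<and> \<phi> \<infinity> = \<infinity> \<and>
     (\<forall>x y. \<forall>l::real. x < \<infinity> \<longrightarrow> y < \<infinity> \<longrightarrow> 0 \<le> l \<longrightarrow> l \<le> 1 \<longrightarrow>
        \<phi> (ennreal l * x + ennreal (1 - l) * y)
          \<le> ennreal l * \<phi> x + ennreal (1 - l) * \<phi> y) \<and>
     (\<forall>u. 0 < u \<longrightarrow> u < \<infinity> \<longrightarrow> continuous (at_left u) \<phi>) \<and>
     (\<exists>u<\<infinity>. \<phi> u \<noteq> 0) \<and>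
     (\<exists>u>0. u < \<infinity> \<and> \<phi> u < \<infinity>)"

(* Sup {} = 0 in ennreal. *)
definition a_young :: "(ennreal \<Rightarrow> ennreal) \<Rightarrow> ennreal" where
  "a_young \<phi> = Sup {u. 0 < u \<and> u < \<infinity> \<and> \<phi> u = 0}"

definition b_young :: "(ennreal \<Rightarrow> ennreal) \<Rightarrow> ennreal" where
  "b_young \<phi> = Sup {u. u < \<infinity> \<and> \<phi> u < \<infinity>}"

(* (a,b] if b is finite, (a,infinity) if b is infinite. *)
definition young_interval :: "(ennreal \<Rightarrow> ennreal) \<Rightarrow> ennreal set" where
  "young_interval \<phi> = {u. a_young \<phi> < u \<and> u \<le> b_young \<phi> \<and> u < \<infinity>}"

(* A positive finite y outside the range of the restricted function can only occur
   if b is finite and y > phi b; the inverse is then given its usual value b. *)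
definition young_inverse :: "(ennreal \<Rightarrow> ennreal) \<Rightarrow> ennreal \<Rightarrow> ennreal" where
  "young_inverse \<phi> y =
     (if y \<in> \<phi> ` young_interval \<phi> then the_inv_into (young_interval \<phi>) \<phi> y
      else b_young \<phi>)"

definition modular_P ::
    "ereal \<Rightarrow> (ennreal \<Rightarrow> ennreal) \<Rightarrow> (real \<Rightarrow> real) \<Rightarrow> (real \<Rightarrow> real) \<Rightarrow> ennreal" where
  "modular_P \<gamma> \<phi> w f =
     Inf {(\<integral>\<^sup>+t\<in>dom_I \<gamma>. \<phi> (rearrangement \<gamma> f t / ennreal (v t)) * ennreal (v t) \<partial>lebesgue)
          | v. majorized \<gamma> v w \<and> pos_decreasing \<gamma> v}"

definition M_space ::
    "ereal \<Rightarrow> (ennreal \<Rightarrow> ennreal) \<Rightarrow> (real \<Rightarrow> real) \<Rightarrow> (real \<Rightarrow> real) set" where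
  "M_space \<gamma> \<phi> w =
     {f \<in> borel_measurable (lebesgue_on (dom_I \<gamma>)).
        \<exists>k>0. modular_P \<gamma> \<phi> w (\<lambda>t. k * f t) < \<infinity>}"

definition M_norm ::
    "ereal \<Rightarrow> (ennreal \<Rightarrow> ennreal) \<Rightarrow> (real \<Rightarrow> real) \<Rightarrow> (real \<Rightarrow> real) \<Rightarrow> ennreal" where
  "M_norm \<gamma> \<phi> w f =
     Inf {ennreal \<epsilon> | \<epsilon>. 0 < \<epsilon> \<and> modular_P \<gamma> \<phi> w (\<lambda>t. f t / \<epsilon>) \<le> 1}"

definition M_fundamental ::
    "ereal \<Rightarrow> (ennreal \<Rightarrow> ennreal) \<Rightarrow> (real \<Rightarrow> real) \<Rightarrow> real \<Rightarrow> ennreal" where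
  "M_fundamental \<gamma> \<phi> w t = M_norm \<gamma> \<phi> w (indicat_real {0<..<t})"

end

(* The modular of k * chi_(0,t) equals W * phi (k t / W), where W = primitive w t. The upper bound
   takes v constant equal to W / t on (0,t) and v = w afterwards; this v is majorized by w because
   W(s) / s decreases. For the lower bound, phi is the supremum on [0,infinity) of affine functions
   p u - q with p, q >= 0; multiplying phi (k / v) >= p k / v - q by v and integrating over (0,t) only
   uses that the integral of v over (0,t) is at most W. Finally, young_inverse phi y is the largest u
   with phi u <= y whenever 0 < y < infinity. *)

theory Submission
  imports Defs
begin

subsection \<open>Young functions\<close>

text \<open>The lower bound is in substance Jensen's inequality for the measure v dm on (0,t). The
  usual form does not fit: \<open>\<phi>\<close> may take the value infinity, v may have mass below
  W, and no measurability of the integrand is established. Affine minorants avoid all three: with p,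
  q >= 0 every term stays in \<open>ennreal\<close>, the sign of q makes an upper bound on the mass
  point the right way, and the integrand enters only through monotonicity of the integral. The bound
  is attained when k / v is constant on (0,t) and v has the full mass W there, which dictates the
  height W / t. A second obstacle is that \<open>majorized\<close> speaks of v*, which agrees with a
  decreasing v only almost everywhere: jumps and the free value at 0 have to be discarded first. The
  formula then comes from solving for epsilon. With k = 1/epsilon the modular is at most 1 iff
  \<open>\<phi>\<close> (t / (epsilon W)) <= 1 / W, that is, iff t / (epsilon W) is at most the
  inverse at 1 / W. This equivalence covers attained values and a jump of \<open>\<phi>\<close> at b
  alike.\<close>

lemma young_scale_le:
  assumes "young_function \<phi>" "0 \<le> l" "l \<le> 1" "x < \<infinity>"
  shows "\<phi> (ennreal l * x) \<le> ennreal l * \<phi> x"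
proof -
  have "\<phi> (ennreal l * x + ennreal (1 - l) * 0) \<le> ennreal l * \<phi> x + ennreal (1 - l) * \<phi> 0"
  proof -
    have "(0::ennreal) < \<infinity>" by simp
    then show ?thesis using assms unfolding young_function_def by blast
  qed
  moreover have "\<phi> 0 = 0" using assms(1) unfolding young_function_def by blast
  ultimately show ?thesis by simp
qed

text \<open>Monotonicity is not an axiom of \<open>young_function\<close>; it follows from convexity
  on the segment from 0 to y together with \<open>\<phi> 0 = 0\<close>.\<close>

lemma young_mono:
  assumes Y: "young_function \<phi>" and "x \<le> y"
  shows "\<phi> x \<le> \<phi> y"
proof (cases "y = \<infinity> \<or> y = 0")
  case True
  then show ?thesis using assms by (auto simp: young_function_def)
next
  case False
  then obtain a b where ab: "x = ennreal a" "y = ennreal b" "0 \<le> a" "0 < b" "a \<le> b"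
    using \<open>x \<le> y\<close>
    by (cases x; cases y) (auto simp: top_unique)
  have x: "x = ennreal (a / b) * y"
    using ab by (simp flip: ennreal_mult)
  have "\<phi> x \<le> ennreal (a / b) * \<phi> y"
    unfolding x by (rule young_scale_le[OF Y]) (use ab in auto)
  also have "\<dots> \<le> 1 * \<phi> y"
    by (rule mult_right_mono) (use ab in auto)
  finally show ?thesis by simp
qed

text \<open>Left continuity in the form used below: a strict lower bound at u survives slightly to
  the left, even if \<open>\<phi> u\<close> is infinite.\<close>

lemma young_left_approx:
  assumes Y: "young_function \<phi>" and "0 < u" "u < \<infinity>" "M < \<phi> u"
  obtains x where "0 < x" "x < u" "M < \<phi> x"
proof -
  have "(\<phi> \<longlongrightarrow> \<phi> u) (at_left u)"
    using assms(1-3) unfolding young_function_def continuous_within by blast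
  then have "eventually (\<lambda>x. M < \<phi> x) (at_left u)"
    using \<open>M < \<phi> u\<close> by (rule order_tendstoD)
  then obtain b where b: "b < u" "\<And>x. b < x \<Longrightarrow> x < u \<Longrightarrow> M < \<phi> x"
    unfolding eventually_at_left[OF \<open>0 < u\<close>] by blast
  obtain x where x: "b < x" "x < u" using dense[OF b(1)] by blast
  have "0 < x" using x(1) by (simp add: le_less_trans)
  then show thesis using that b x by blast
qed

section \<open>Affine minorants of a Young function\<close>

text \<open>Passes to a real-valued function on the set of finiteness, where supporting lines of
  convex functions are available.\<close>

lemma young_convex_on:
  assumes Y: "young_function \<phi>"
  defines "I \<equiv> {x. 0 \<le> x \<and> \<phi> (ennreal x) < \<infinity>}"
  shows "convex_on I (\<lambda>x. enn2real (\<phi> (ennreal x)))"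
proof -
  have cvx: "\<phi> (ennreal ((1 - l) * x + l * y))
      \<le> ennreal ((1 - l) * enn2real (\<phi> (ennreal x)) + l * enn2real (\<phi> (ennreal y)))"
    if "x \<in> I" "y \<in> I" "0 \<le> l" "l \<le> 1" for x y l
  proof -
    have "\<phi> (ennreal (1 - l) * ennreal x + ennreal (1 - (1 - l)) * ennreal y)
        \<le> ennreal (1 - l) * \<phi> (ennreal x) + ennreal (1 - (1 - l)) * \<phi> (ennreal y)"
    proof -
      have "0 \<le> 1 - l" "1 - l \<le> 1" "ennreal x < \<infinity>" "ennreal y < \<infinity>" using that by auto
      then show ?thesis using Y unfolding young_function_def by blast
    qed
    moreover have "\<phi> (ennreal x) = ennreal (enn2real (\<phi> (ennreal x)))"
      "\<phi> (ennreal y) = ennreal (enn2real (\<phi> (ennreal y)))"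
      using that by (simp_all add: I_def)
    moreover have "ennreal (1 - l) * ennreal x + ennreal (1 - (1 - l)) * ennreal y
        = ennreal ((1 - l) * x + l * y)"
      using that by (simp add: I_def flip: ennreal_mult ennreal_plus)
    moreover have "ennreal (1 - l) * ennreal a + ennreal (1 - (1 - l)) * ennreal b
        = ennreal ((1 - l) * a + l * b)" if "0 \<le> a" "0 \<le> b" for a b
      using that \<open>0 \<le> l\<close> \<open>l \<le> 1\<close> by (simp flip: ennreal_mult ennreal_plus)
    ultimately show ?thesis
      by (metis enn2real_nonneg)
  qed
  have "(1 - l) * x + l * y \<in> I" if "x \<in> I" "y \<in> I" "0 \<le> l" "l \<le> 1" for x y l
    using le_less_trans[OF cvx[OF that] ennreal_less_top] that by (auto simp: I_def)
  then have "convex I"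
    unfolding convex_alt by simp
  then show ?thesis
  proof (rule convex_onI[rotated])
    fix l x y :: real assume *: "0 < l" "l < 1" "x \<in> I" "y \<in> I"
    have "enn2real (\<phi> (ennreal ((1 - l) * x + l * y)))
      \<le> (1 - l) * enn2real (\<phi> (ennreal x)) + l * enn2real (\<phi> (ennreal y))"
      using cvx[of x y l] * by (intro enn2real_leI) auto
    then show "enn2real (\<phi> (ennreal ((1 - l) *\<^sub>R x + l *\<^sub>R y)))
      \<le> (1 - l) * enn2real (\<phi> (ennreal x)) + l * enn2real (\<phi> (ennreal y))" by simp
  qed
qed

text \<open>A supporting line at u itself may not exist, since u can be an endpoint of the set of
  finiteness or lie beyond it. As m is strictly below \<open>\<phi> u\<close>, a line based at some
  x1 < u suffices: a steep one if \<open>\<phi>\<close> is already infinite there, a supporting one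
  otherwise.\<close>

lemma young_minorant:
  assumes Y: "young_function \<phi>" and u: "0 < u" and M: "ennreal m < \<phi> (ennreal u)" "0 \<le> m"
  obtains p q where "0 \<le> p" "0 \<le> q" "m \<le> p * u - q"
    "\<And>x. 0 \<le> x \<Longrightarrow> ennreal (p * x) \<le> \<phi> (ennreal x) + ennreal q"
proof (cases "\<exists>x. 0 < x \<and> x < u \<and> \<phi> (ennreal x) = \<infinity>")
  case True
  then obtain x1 where x1: "0 < x1" "x1 < u" "\<phi> (ennreal x1) = \<infinity>" by blast
  \<comment> \<open>The line through (x1, 0) and (u, m): it is nonpositive up to x1, and
    \<open>\<phi>\<close> is infinite after x1.\<close>
  define p where "p = m / (u - x1)"
  have p: "0 \<le> p" using x1 M by (simp add: p_def)
  show thesis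
  proof (rule that[of p "p * x1"])
    show "m \<le> p * u - p * x1"
    proof -
      have "p * u - p * x1 = p * (u - x1)" by (simp add: right_diff_distrib)
      then show ?thesis using x1 by (simp add: p_def)
    qed
    fix x :: real assume "0 \<le> x"
    show "ennreal (p * x) \<le> \<phi> (ennreal x) + ennreal (p * x1)"
    proof (cases "x \<le> x1")
      case True
      then have "ennreal (p * x) \<le> ennreal (p * x1)"
        using p x1 by (auto intro!: ennreal_leI mult_left_mono)
      then show ?thesis by (simp add: add_increasing)
    next
      case False
      then have "\<phi> (ennreal x) = \<infinity>"
        using young_mono[OF Y, of "ennreal x1" "ennreal x"] x1 by (simp add: ennreal_leI top_unique)
      then show ?thesis by simp
    qed
  qed (use p x1 in auto)
next
  case False
  define I where "I = {x. 0 \<le> x \<and> \<phi> (ennreal x) < \<infinity>}"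
  define g where "g x = enn2real (\<phi> (ennreal x))" for x
  have "\<phi> (ennreal x) < \<infinity>" if "0 < x" "x < u" for x
    using False that by (metis top.not_eq_extremum infinity_ennreal_def)
  then have I: "{0<..<u} \<subseteq> I" by (auto simp: I_def)
  \<comment> \<open>Moving left of u gives a base point in the interior of the set of finiteness at
    which the value still exceeds m.\<close>
  obtain e where e: "0 < e" "e < ennreal u" "ennreal m < \<phi> e"
    using young_left_approx[OF Y _ _ M(1)] u by auto
  then obtain x1 where x1: "e = ennreal x1" "0 < x1" "x1 < u"
    by (cases e) (auto simp: ennreal_less_iff)
  have g: "\<phi> (ennreal x) = ennreal (g x)" if "x \<in> I" for x
    using that by (simp add: I_def g_def)
  have "x1 \<in> I" using I x1 by auto
  then have gx1: "m < g x1" using e g[of x1] x1 M by (simp add: ennreal_less_iff)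
  have "x1 \<in> interior I" using I x1 by (auto intro: interiorI[of "{0<..<u}"])
  \<comment> \<open>The infimum of the difference quotients to the right of x1, i.e. the right
    derivative at x1.\<close>
  moreover define p where "p = Inf ((\<lambda>t. (g x1 - g t) / (x1 - t)) ` ({x1<..} \<inter> I))"
  ultimately have tangent: "g y \<ge> g x1 + p * (y - x1)" if "y \<in> I" for y
    using convex_le_Inf_differential[of I g x1 y] young_convex_on[OF Y] that
    unfolding I_def g_def by blast
  have g0: "0 \<in> I" "g 0 = 0" using Y by (auto simp: I_def g_def young_function_def)
  \<comment> \<open>The supporting line evaluated at 0, where \<open>g\<close> vanishes, yields both
    signs: the intercept q = p x1 - g x1 is nonnegative, and p cannot be negative because g x1 > m
    >= 0.\<close>
  have px1: "g x1 \<le> p * x1" using tangent[OF g0(1)] g0 by simp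
  have p: "0 \<le> p"
    using px1 gx1 M x1 mult_neg_pos[of p x1] by linarith
  show thesis
  proof (rule that[of p "p * x1 - g x1"])
    show "m \<le> p * u - (p * x1 - g x1)"
      using gx1 mult_left_mono[of x1 u p] p x1 by simp
    fix x :: real assume "0 \<le> x"
    show "ennreal (p * x) \<le> \<phi> (ennreal x) + ennreal (p * x1 - g x1)"
    proof (cases "x \<in> I")
      case True
      have "0 \<le> g x" by (simp add: g_def)
      then show ?thesis
        using tangent[OF True] px1 by (simp add: g[OF True] algebra_simps flip: ennreal_plus)
    next
      case False
      then show ?thesis using \<open>0 \<le> x\<close> by (auto simp: I_def not_less top_unique)
    qed
  qed (use p px1 in auto)
qed

section \<open>One-sided limits, sublevel sets and the inverse\<close>

text \<open>Right continuity below b, which comes from convexity: on a chord from u to a point of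
  finiteness, \<open>\<phi>\<close> lies under (1 - l) c + l d, and this tends to c =
  \<open>\<phi> u\<close> as l decreases to 0.\<close>

lemma young_right_approx:
  assumes Y: "young_function \<phi>" and "u < b_young \<phi>" and y: "\<And>x. u < x \<Longrightarrow> x < b_young \<phi> \<Longrightarrow> y \<le> \<phi> x"
  shows "y \<le> \<phi> u"
proof -
  obtain b where b: "u < b" "b < \<infinity>" "\<phi> b < \<infinity>"
    using \<open>u < b_young \<phi>\<close> by (auto simp: b_young_def less_Sup_iff)
  have fu: "\<phi> u < \<infinity>" using young_mono[OF Y, of u b] b by (meson le_less_trans less_imp_le)
  have bb: "b \<le> b_young \<phi>" using b by (auto simp: b_young_def intro: Sup_upper)
  obtain c d where cd: "\<phi> u = ennreal c" "0 \<le> c" "\<phi> b = ennreal d" "0 \<le> d"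
    using fu b by (cases "\<phi> u"; cases "\<phi> b") auto
  obtain r s where rs: "u = ennreal r" "b = ennreal s" "0 \<le> r" "r < s"
    using b by (cases u; cases b) (auto simp: ennreal_less_iff)
  have "y \<le> ennreal ((1 - l) * c + l * d)" if l: "0 < l" "l < 1" for l :: real
  proof -
    have eq: "ennreal (1 - l) * u + ennreal (1 - (1 - l)) * b = ennreal (r + l * (s - r))"
    proof -
      have "ennreal (1 - l) * u + ennreal (1 - (1 - l)) * b = ennreal ((1 - l) * r + l * s)"
        using rs l by (simp flip: ennreal_mult ennreal_plus)
      then show ?thesis by (simp add: algebra_simps)
    qed
    have "y \<le> \<phi> (ennreal (r + l * (s - r)))"
    proof (rule y)
      show "u < ennreal (r + l * (s - r))" using rs l by (simp add: ennreal_less_iff)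
      have "r + l * (s - r) < s" 
    proof -
      have "l * (s - r) < 1 * (s - r)" using rs l by (intro mult_strict_right_mono) auto
      then show ?thesis by simp
    qed
      then have "ennreal (r + l * (s - r)) < b" using rs l by (simp add: ennreal_less_iff del: ennreal_plus)
      then show "ennreal (r + l * (s - r)) < b_young \<phi>" using bb by (rule less_le_trans)
    qed
    also have "\<dots> \<le> ennreal (1 - l) * \<phi> u + ennreal (1 - (1 - l)) * \<phi> b"
    proof -
      have "0 \<le> 1 - l" "1 - l \<le> 1" "u < \<infinity>" using l rs by auto
      then show ?thesis
        using Y b unfolding eq[symmetric] young_function_def by blast
    qed
    also have "\<dots> = ennreal ((1 - l) * c + l * d)"
      using cd l by (simp flip: ennreal_mult ennreal_plus)
    finally show ?thesis .
  qed
  then have "eventually (\<lambda>l. y \<le> ennreal ((1 - l) * c + l * d)) (at_right 0)"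
    unfolding eventually_at_right[OF zero_less_one] by (auto intro!: exI[of _ 1])
  moreover have "((\<lambda>l. ennreal ((1 - l) * c + l * d)) \<longlongrightarrow> ennreal ((1 - 0) * c + 0 * d)) (at_right 0)"
    by (intro tendsto_intros)
  ultimately show ?thesis
    using tendsto_lowerbound[of _ _ "at_right (0::real)" y] cd by simp
qed

text \<open>The threshold s is the supremum of the sublevel set. It is positive because
  \<open>\<phi>\<close> is small near 0, finite because \<open>\<phi>\<close> grows at least
  linearly once positive, and itself in the set by left continuity.\<close>

lemma young_sublevel:
  assumes Y: "young_function \<phi>" and y: "0 < y" "y < \<infinity>"
  obtains s where "0 < s" "s < \<infinity>" "\<And>u. u < \<infinity> \<Longrightarrow> \<phi> u \<le> y \<longleftrightarrow> u \<le> s"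
proof -
  define S where "S = {u. u < \<infinity> \<and> \<phi> u \<le> y}"
  obtain r where r: "y = ennreal r" "0 < r" using y by (cases y) auto
  obtain c where c: "c < \<infinity>" "\<phi> c \<noteq> 0" using Y by (auto simp: young_function_def)
  obtain d where d: "0 < d" "d < \<infinity>" "\<phi> d < \<infinity>" using Y by (auto simp: young_function_def)
  have "\<exists>z\<in>S. 0 < z"
  proof -
    obtain e where e: "\<phi> d = ennreal e" "0 \<le> e" using d by (cases "\<phi> d") auto
    \<comment> \<open>Scaling d by l multiplies the value by at most l, so l e <= r is wanted; the
      summand 1 avoids dividing by e = 0.\<close>
    define l where "l = min 1 (r / (e + 1))"
    have l: "0 < l" "l \<le> 1" "l * e \<le> r"
    proof -
      show "0 < l" "l \<le> 1" using e r by (auto simp: l_def)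
      have "l * e \<le> r / (e + 1) * (e + 1)" using e r by (intro mult_mono) (auto simp: l_def)
      then show "l * e \<le> r" using e by simp
    qed
    have "\<phi> (ennreal l * d) \<le> ennreal l * \<phi> d"
      by (rule young_scale_le[OF Y]) (use l d in auto)
    also have "\<dots> \<le> y" using l e r by (simp add: ennreal_leI flip: ennreal_mult)
    finally have "ennreal l * d \<in> S" using d by (simp add: S_def ennreal_mult_less_top)
    moreover have "0 < ennreal l * d" using l d by (simp add: ennreal_zero_less_mult_iff)
    ultimately show ?thesis by blast
  qed
  then have s0: "0 < Sup S" by (auto simp: less_Sup_iff)
  have "\<exists>B<\<infinity>. \<forall>z\<in>S. z \<le> B"
  proof -
    have "0 < c" using c Y by (cases "c = 0") (auto simp: young_function_def zero_less_iff_neq_zero)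
    obtain c' where c': "c = ennreal c'" "0 < c'" using c \<open>0 < c\<close> by (cases c) auto
    obtain e where e: "0 < e" "ennreal e \<le> \<phi> c"
    proof (cases "\<phi> c")
      case (real r')
      then show ?thesis using c by (intro that[of r']) auto
    qed (auto intro: that[of 1])
    \<comment> \<open>Convexity between 0 and z gives e <= (c' / z) r, so z <= c' r / e. The extra
      c' guarantees c' / z <= 1 for every z > B, as the scaling requires.\<close>
    define B where "B = c' * (r / e + 1)"
    have "z \<le> ennreal B" if zS: "z \<in> S" for z
    proof (rule ccontr)
      assume n: "\<not> z \<le> ennreal B"
      obtain z' where z': "z = ennreal z'" "0 \<le> z'"
        using zS unfolding S_def by (cases z) auto
      have "B < z'" using n z' by (meson ennreal_leI not_le)
      have "c' * 1 \<le> B" "0 < r / e" unfolding B_def using c' r e by (auto intro!: mult_left_mono)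
      then have "0 < z'" "c' \<le> z'" using \<open>B < z'\<close> c' by auto
      have "\<phi> (ennreal (c' / z') * z) \<le> ennreal (c' / z') * \<phi> z"
        by (rule young_scale_le[OF Y]) (use \<open>0 < z'\<close> \<open>c' \<le> z'\<close> c' z' in auto)
      also have "\<dots> \<le> ennreal (c' / z') * y"
        using zS by (auto simp: S_def intro: mult_left_mono)
      also have "ennreal (c' / z') * z = c" using c' z' \<open>0 < z'\<close> by (simp flip: ennreal_mult)
      finally have "\<phi> c \<le> ennreal (c' / z' * r)"
        using r c' \<open>0 < z'\<close> by (simp flip: ennreal_mult)
      then have "ennreal e \<le> ennreal (c' / z' * r)"
        using e by (meson order_trans)
      then have "e \<le> c' / z' * r"
        using r c' \<open>0 < z'\<close> by (simp add: ennreal_le_iff)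
      then have "z' \<le> c' * (r / e)" using e \<open>0 < z'\<close> by (simp add: field_simps)
      also have "\<dots> \<le> B" using c' by (simp add: B_def distrib_left)
      finally show False using \<open>B < z'\<close> by simp
    qed
    then show ?thesis by (intro exI[of _ "ennreal B"]) auto
  qed
  then have s1: "Sup S < \<infinity>" by (meson Sup_least le_less_trans)
  have s2: "\<phi> (Sup S) \<le> y"
  proof (rule ccontr)
    assume "\<not> \<phi> (Sup S) \<le> y"
    then obtain x where x: "x < Sup S" "y < \<phi> x"
      using young_left_approx[OF Y s0 s1] by (metis not_le)
    then obtain z where "z \<in> S" "x < z" by (auto simp: less_Sup_iff)
    then have "\<phi> x \<le> \<phi> z" "\<phi> z \<le> y" using young_mono[OF Y, of x z] by (auto simp: S_def)
    then show False using x by simp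
  qed
  show thesis
  proof (rule that[OF s0 s1])
    fix u :: ennreal assume "u < \<infinity>"
    then have "\<phi> u \<le> y \<Longrightarrow> u \<le> Sup S" by (auto simp: S_def intro: Sup_upper)
    moreover have "u \<le> Sup S \<Longrightarrow> \<phi> u \<le> y"
      using s2 young_mono[OF Y, of u "Sup S"] by simp
    ultimately show "\<phi> u \<le> y \<longleftrightarrow> u \<le> Sup S" by blast
  qed
qed

text \<open>Shrinking s to u by a factor below 1 strictly shrinks a positive finite value. This
  yields injectivity right of a.\<close>

lemma young_strict_mono:
  assumes Y: "young_function \<phi>" and "u < s" "s < \<infinity>" "0 < \<phi> u" "\<phi> s < \<infinity>"
  shows "\<phi> u < \<phi> s"
proof -
  obtain a b where ab: "u = ennreal a" "s = ennreal b" "0 \<le> a" "a < b"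
    using assms by (cases u; cases s) (auto simp: ennreal_less_iff)
  have "\<phi> (ennreal (a / b) * s) \<le> ennreal (a / b) * \<phi> s"
    by (rule young_scale_le[OF Y]) (use ab in auto)
  also have "ennreal (a / b) * s = u" using ab by (simp flip: ennreal_mult)
  also have "ennreal (a / b) * \<phi> s < 1 * \<phi> s"
  proof (rule ennreal_mult_strict_right_mono)
    show "ennreal (a / b) < 1" using ab by (simp add: ennreal_less_one_iff)
    show "0 < \<phi> s" using assms young_mono[OF Y, of u s] by (simp add: less_le_trans)
  qed (use assms in auto)
  finally show ?thesis by simp
qed

text \<open>The inequality is strict because, by left continuity, \<open>\<phi>\<close> is already
  positive at some point before s.\<close>

lemma a_young_less:
  assumes Y: "young_function \<phi>" and "0 < \<phi> s" "s < \<infinity>"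
  shows "a_young \<phi> < s"
proof -
  have "0 < s" using assms by (cases "s = 0") (auto simp: young_function_def zero_less_iff_neq_zero)
  then obtain x where x: "x < s" "0 < \<phi> x" using young_left_approx[OF Y _ assms(3,2)] by blast
  have "u \<le> x" if "\<phi> u = 0" for u
    using young_mono[OF Y, of x u] x that by (metis le_cases not_le)
  then have "a_young \<phi> \<le> x" unfolding a_young_def by (auto intro: Sup_least)
  then show ?thesis using x by simp
qed

text \<open>Identifies the piecewise \<open>young_inverse\<close> with the threshold of the sublevel
  set, so that the norm computation needs no case distinction on whether y is a value of
  \<open>\<phi>\<close>.\<close>

lemma young_inverse_sublevel:
  assumes Y: "young_function \<phi>" and y: "0 < y" "y < \<infinity>"
  shows "0 < young_inverse \<phi> y" "young_inverse \<phi> y < \<infinity>"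
    "\<And>u. u < \<infinity> \<Longrightarrow> \<phi> u \<le> y \<longleftrightarrow> u \<le> young_inverse \<phi> y"
proof -
  obtain s where s: "0 < s" "s < \<infinity>" "\<And>u. u < \<infinity> \<Longrightarrow> \<phi> u \<le> y \<longleftrightarrow> u \<le> s"
    using young_sublevel[OF Y y] by blast
  have fs: "\<phi> s \<le> y" using s by auto
  then have sb: "s \<le> b_young \<phi>"
    unfolding b_young_def using s(2) y(2) by (intro Sup_upper) (simp add: le_less_trans)
  have unique: "u = s" if "u \<in> young_interval \<phi>" "\<phi> u = y" for u
  proof (rule ccontr)
    assume "u \<noteq> s"
    moreover have u: "u < \<infinity>" using that by (auto simp: young_interval_def)
    ultimately have "u < s" using s(3)[of u] that by auto
    then have "\<phi> u < \<phi> s" using young_strict_mono[OF Y] s fs y that by (meson le_less_trans)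
    then show False using that fs by simp
  qed
  \<comment> \<open>Below b, right continuity excludes a jump over y: points just after s have
    values above y, so \<open>\<phi> s\<close> is at least y.\<close>
  have attained: "\<phi> s = y" "s \<in> young_interval \<phi>" if "s < b_young \<phi>"
  proof -
    have "y \<le> \<phi> s"
    proof (rule young_right_approx[OF Y that])
      fix x assume "s < x" "x < b_young \<phi>"
      then have "x < \<infinity>" by (metis less_le_trans top_greatest infinity_ennreal_def)
      then show "y \<le> \<phi> x" using s(3)[of x] \<open>s < x\<close> by (simp add: not_le[symmetric])
    qed
    then show *: "\<phi> s = y" using fs by simp
    show "s \<in> young_interval \<phi>"
      using a_young_less[OF Y, of s] * y s sb by (auto simp: young_interval_def)
  qed
  have "young_inverse \<phi> y = s"
  proof (cases "y \<in> \<phi> ` young_interval \<phi>")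
    case True
    then have "s \<in> young_interval \<phi>" "\<phi> s = y" using unique by auto
    then have "the_inv_into (young_interval \<phi>) \<phi> y = s"
      unfolding the_inv_into_def using unique by (intro the_equality) blast+
    then show ?thesis using True by (simp add: young_inverse_def)
  next
    case False
    \<comment> \<open>If y is not attained then s = b, which is the default value of
      \<open>young_inverse\<close>.\<close>
    then have "\<not> s < b_young \<phi>" using attained by blast
    then show ?thesis using False sb by (simp add: young_inverse_def)
  qed
  then show "0 < young_inverse \<phi> y" "young_inverse \<phi> y < \<infinity>"
    "\<And>u. u < \<infinity> \<Longrightarrow> \<phi> u \<le> y \<longleftrightarrow> u \<le> young_inverse \<phi> y" using s by auto
qed

subsection \<open>Rearrangements of decreasing functions\<close>

text \<open>The value at the point 0 is discarded because \<open>pos_decreasing\<close> does not restrict it.\<close>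

definition zero_ext :: "ereal \<Rightarrow> (real \<Rightarrow> real) \<Rightarrow> real \<Rightarrow> ennreal" where
  "zero_ext \<gamma> v s = (if s \<in> dom_I \<gamma> - {0} then ennreal (v s) else 0)"

lemma ereal_less_downward: "x \<le> y \<Longrightarrow> ereal y < \<gamma> \<Longrightarrow> ereal x < \<gamma>"
  by (rule le_less_trans[of _ "ereal y"]) simp_all

lemma dom_I_borel [measurable]: "dom_I \<gamma> \<in> sets borel"
  unfolding dom_I_def by measurable

lemma zero_ext_measurable:
  assumes "pos_decreasing \<gamma> v"
  shows "zero_ext \<gamma> v \<in> borel_measurable lebesgue"
proof -
  let ?D = "dom_I \<gamma> - {0}"
  have "mono_on ?D (\<lambda>s. - v s)"
    using assms by (auto simp: pos_decreasing_def monotone_on_def)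
  then have "(\<lambda>s. - v s) \<in> borel_measurable (restrict_space borel ?D)"
    by (rule borel_measurable_mono_on_fnc)
  then have "(\<lambda>s. indicator ?D s *\<^sub>R (- v s)) \<in> borel_measurable borel"
    by (subst (asm) borel_measurable_restrict_space_iff) auto
  then have "(\<lambda>s. ennreal (- (indicator ?D s *\<^sub>R (- v s)))) \<in> borel_measurable borel"
    by measurable
  moreover have "zero_ext \<gamma> v = (\<lambda>s. ennreal (- (indicator ?D s *\<^sub>R (- v s))))"
    by (auto simp: zero_ext_def fun_eq_iff indicator_def)
  ultimately show ?thesis
    by (simp add: measurable_completion)
qed

text \<open>Inside I, |v| exceeds v s only on a subset of [0,s], whatever the value at 0, so v s
  competes in the infimum. Beyond I, the whole domain has measure at most s and every positive level
  competes.\<close>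

lemma rearrangement_pos_decreasing_le:
  assumes v: "pos_decreasing \<gamma> v" and s: "0 < s"
  shows "rearrangement \<gamma> v s \<le> zero_ext \<gamma> v s"
proof (cases "s \<in> dom_I \<gamma>")
  case True
  then have "0 < v s" using v s by (auto simp: pos_decreasing_def)
  have "distribution_fun \<gamma> v (v s) \<le> emeasure lebesgue {0..s}"
    unfolding distribution_fun_def
  proof (rule emeasure_mono)
    show "{x \<in> dom_I \<gamma>. v s < \<bar>v x\<bar>} \<subseteq> {0..s}"
    proof
      fix x assume x: "x \<in> {x \<in> dom_I \<gamma>. v s < \<bar>v x\<bar>}"
      have "x \<le> s"
      proof (rule ccontr)
        assume "\<not> x \<le> s"
        then have "v x \<le> v s" "0 < v x" using v x s True by (auto simp: pos_decreasing_def monotone_on_def)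
        then show False using x by simp
      qed
      then show "x \<in> {0..s}" using x by (auto simp: dom_I_def)
    qed
  qed simp
  then have "distribution_fun \<gamma> v (v s) \<le> ennreal s" using s by simp
  then have "rearrangement \<gamma> v s \<le> ennreal (v s)"
    unfolding rearrangement_def using \<open>0 < v s\<close> by (intro Inf_lower) auto
  then show ?thesis using True s by (simp add: zero_ext_def)
next
  case False
  then have "\<not> ereal s < \<gamma>" using s by (simp add: dom_I_def)
  then have "dom_I \<gamma> \<subseteq> {0..s}"
  proof -
    have "x \<le> s" if "ereal x < \<gamma>" for x
      using ereal_less_downward[of s x \<gamma>] that \<open>\<not> ereal s < \<gamma>\<close> by linarith
    then show ?thesis by (auto simp: dom_I_def)
  qed
  then have "distribution_fun \<gamma> v r \<le> emeasure lebesgue {0..s}" for r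
    unfolding distribution_fun_def by (intro emeasure_mono) auto
  then have "distribution_fun \<gamma> v r \<le> ennreal s" for r using s by simp
  then have "rearrangement \<gamma> v s \<le> ennreal r" if "0 < r" for r
    unfolding rearrangement_def using that by (intro Inf_lower) auto
  then have "rearrangement \<gamma> v s \<le> 0" by - (rule ennreal_le_epsilon, simp)
  then show ?thesis by simp
qed

text \<open>By continuity, a level r < v s is exceeded up to some x > s, so its distribution is at
  least x and r does not compete. At a jump this can fail, since v* takes the limit from the
  right.\<close>

lemma rearrangement_pos_decreasing_ge:
  assumes v: "pos_decreasing \<gamma> v" and s: "s \<in> dom_I \<gamma> - {0}"
    and c: "continuous (at s within (dom_I \<gamma> - {0})) v"
  shows "ennreal (v s) \<le> rearrangement \<gamma> v s"
  unfolding rearrangement_def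
proof (rule Inf_greatest, safe)
  fix r :: real assume r: "0 < r" "distribution_fun \<gamma> v r \<le> ennreal s"
  have s0: "0 < s" "ereal s < \<gamma>" using s by (auto simp: dom_I_def)
  show "ennreal (v s) \<le> ennreal r"
  proof (rule ccontr)
    assume "\<not> ennreal (v s) \<le> ennreal r"
    then have "r < v s" using r by (meson ennreal_leI not_le)
    then have "eventually (\<lambda>x. r < v x) (at s within (dom_I \<gamma> - {0}))"
      using c by (auto simp: continuous_within intro: order_tendstoD)
    then obtain d where d: "0 < d" "\<And>x. x \<in> dom_I \<gamma> - {0} \<Longrightarrow> x \<noteq> s \<Longrightarrow> dist x s < d \<Longrightarrow> r < v x"
      unfolding eventually_at by blast
    \<comment> \<open>A point of I beyond s, which keeps x below \<open>\<gamma>\<close>.\<close>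
    obtain g where g: "s < g" "ereal g < \<gamma>"
      using ereal_dense2[OF s0(2)] by auto
    define x where "x = min g (s + d / 2)"
    have x: "s < x" "ereal x < \<gamma>" "x \<in> dom_I \<gamma> - {0}" "dist x s < d"
    proof -
      show "s < x" using g d by (simp add: x_def)
      have "x \<le> g" by (simp add: x_def)
      then show "ereal x < \<gamma>" using g(2) by (rule ereal_less_downward)
      then show "x \<in> dom_I \<gamma> - {0}" using \<open>s < x\<close> s0 by (auto simp: dom_I_def)
      show "dist x s < d" using \<open>s < x\<close> d by (auto simp: x_def dist_real_def)
    qed
    have sub: "{0<..x} \<subseteq> {z \<in> dom_I \<gamma>. r < \<bar>v z\<bar>}"
    proof
      fix z assume z: "z \<in> {0<..x}"
      then have zD: "z \<in> dom_I \<gamma> - {0}"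
        using ereal_less_downward[OF _ x(2), of z] by (simp add: dom_I_def)
      then have "v x \<le> v z" using v x z by (auto simp: pos_decreasing_def monotone_on_def)
      then show "z \<in> {z \<in> dom_I \<gamma>. r < \<bar>v z\<bar>}" using d(2)[OF x(3)] x zD by auto
    qed
    \<comment> \<open>Monotonicity of the measure needs the larger set measurable; the point 0,
      where v is unconstrained, is split off.\<close>
    have "{z \<in> dom_I \<gamma> - {0}. r < v z} \<in> sets lebesgue"
    proof -
      have "{z \<in> dom_I \<gamma> - {0}. r < v z} = {z \<in> space lebesgue. ennreal r < zero_ext \<gamma> v z}"
        using r by (auto simp: zero_ext_def ennreal_less_iff split: if_splits)
      also have "\<dots> \<in> sets lebesgue"
        by (rule borel_measurable_less[OF borel_measurable_const zero_ext_measurable[OF v]])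
      finally show ?thesis .
    qed
    moreover have "{z \<in> dom_I \<gamma>. r < \<bar>v z\<bar>} =
      {z \<in> dom_I \<gamma> - {0}. r < v z} \<union> (if 0 \<in> dom_I \<gamma> \<and> r < \<bar>v 0\<bar> then {0} else {})"
    proof -
      have "\<bar>v z\<bar> = v z" if "z \<in> dom_I \<gamma>" "z \<noteq> 0" for z
        using v that by (auto simp: pos_decreasing_def intro!: abs_of_pos)
      then have "z \<in> {z \<in> dom_I \<gamma>. r < \<bar>v z\<bar>} \<longleftrightarrow>
        z \<in> {z \<in> dom_I \<gamma> - {0}. r < v z} \<union> (if 0 \<in> dom_I \<gamma> \<and> r < \<bar>v 0\<bar> then {0} else {})" for z
        by (cases "z = 0") auto
      then show ?thesis by (rule set_eqI)
    qed
    ultimately have meas: "{z \<in> dom_I \<gamma>. r < \<bar>v z\<bar>} \<in> sets lebesgue"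
      by (simp only:) (rule sets.Un, auto)
    have "ennreal x = emeasure lebesgue {0<..x}" using x s0 by simp
    also have "\<dots> \<le> distribution_fun \<gamma> v r"
      unfolding distribution_fun_def using sub meas by (rule emeasure_mono)
    also have "\<dots> \<le> ennreal s" by (rule r)
    finally show False using x s0 by simp
  qed
qed

text \<open>A monotone function has only countably many discontinuities, and countable sets are
  null.\<close>

lemma AE_rearrangement_pos_decreasing:
  assumes v: "pos_decreasing \<gamma> v"
  shows "AE s in lebesgue. 0 < s \<longrightarrow> rearrangement \<gamma> v s = zero_ext \<gamma> v s"
proof -
  let ?D = "dom_I \<gamma> - {0}"
  define C where "C = {s \<in> ?D. \<not> continuous (at s within ?D) v}"
  have "mono_on ?D (\<lambda>s. - v s)"
    using assms by (auto simp: pos_decreasing_def monotone_on_def)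
  then have "countable {s \<in> ?D. \<not> continuous (at s within ?D) (\<lambda>s. - v s)}"
    by (rule mono_on_ctble_discont)
  moreover have "continuous (at s within ?D) (\<lambda>s. - v s) \<longleftrightarrow> continuous (at s within ?D) v" for s
    using continuous_minus[of "at s within ?D" v] continuous_minus[of "at s within ?D" "\<lambda>s. - v s"] by auto
  ultimately have "countable C" by (simp add: C_def)
  then have "C \<in> null_sets lebesgue"
    by (intro null_sets_completionI countable_imp_null_set_lborel)
  then have "AE s in lebesgue. s \<notin> C" by (rule AE_not_in)
  then show ?thesis
  proof eventually_elim
    case (elim s)
    show ?case
    proof
      assume "0 < s"
      have "zero_ext \<gamma> v s \<le> rearrangement \<gamma> v s"
        using rearrangement_pos_decreasing_ge[OF v, of s] elim by (auto simp: zero_ext_def C_def)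
      then show "rearrangement \<gamma> v s = zero_ext \<gamma> v s"
        using rearrangement_pos_decreasing_le[OF v \<open>0 < s\<close>] by simp
    qed
  qed
qed

lemma majorized_iff:
  assumes v: "pos_decreasing \<gamma> v" and w: "pos_decreasing \<gamma> w"
  shows "majorized \<gamma> v w \<longleftrightarrow>
    (\<forall>t>0. (\<integral>\<^sup>+s\<in>{0<..<t}. zero_ext \<gamma> v s \<partial>lebesgue) \<le> (\<integral>\<^sup>+s\<in>{0<..<t}. zero_ext \<gamma> w s \<partial>lebesgue))"
proof -
  have "(\<integral>\<^sup>+s\<in>{0<..<t}. rearrangement \<gamma> u s \<partial>lebesgue) = (\<integral>\<^sup>+s\<in>{0<..<t}. zero_ext \<gamma> u s \<partial>lebesgue)"
    if "pos_decreasing \<gamma> u" for u t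
    using AE_rearrangement_pos_decreasing[OF that]
    by (intro nn_integral_cong_AE) (auto split: split_indicator elim: eventually_mono)
  then show ?thesis using v w by (simp add: majorized_def)
qed

lemma zero_ext_eq: "ereal t \<le> \<gamma> \<Longrightarrow> 0 < s \<Longrightarrow> s < t \<Longrightarrow> zero_ext \<gamma> v s = ennreal (v s)"
  using less_le_trans[of "ereal s" "ereal t" \<gamma>] by (simp add: zero_ext_def dom_I_def)

lemma primitive_eq_zero_ext:
  assumes "ereal t \<le> \<gamma>"
  shows "primitive w t = (\<integral>\<^sup>+s\<in>{0<..<t}. zero_ext \<gamma> w s \<partial>lebesgue)"
  unfolding primitive_def
  by (rule nn_integral_cong) (auto simp: zero_ext_eq[OF assms] split: split_indicator)

section \<open>Multiples of an indicator function\<close>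

lemma distribution_fun_indicator:
  assumes "0 < k" "0 < t" "ereal t < \<gamma>" "0 \<le> r"
  shows "distribution_fun \<gamma> (\<lambda>s. k * indicat_real {0<..<t} s) r = (if r < k then ennreal t else 0)"
proof -
  have "ereal x < \<gamma>" if "x < t" for x
    using ereal_less_downward[of x t \<gamma>] that assms by simp
  then have "{s \<in> dom_I \<gamma>. r < \<bar>k * indicat_real {0<..<t} s\<bar>} = (if r < k then {0<..<t} else {})"
    using assms by (auto simp: dom_I_def indicator_def split: if_splits)
  then show ?thesis using assms by (simp add: distribution_fun_def)
qed

lemma rearrangement_indicator:
  assumes "0 < k" "0 < t" "ereal t < \<gamma>" "0 \<le> s"
  shows "rearrangement \<gamma> (\<lambda>s. k * indicat_real {0<..<t} s) s = (if s < t then ennreal k else 0)"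
proof (cases "s < t")
  case True
  have "{ennreal r | r. 0 < r \<and> distribution_fun \<gamma> (\<lambda>s. k * indicat_real {0<..<t} s) r \<le> ennreal s}
      = ennreal ` {k..}"
    using True assms by (auto simp: distribution_fun_indicator image_iff split: if_splits)
  moreover have "Inf (ennreal ` {k..}) = ennreal k"
    using assms by (intro antisym Inf_lower Inf_greatest) (auto intro: ennreal_leI)
  ultimately show ?thesis using True by (simp add: rearrangement_def)
next
  case False
  have "rearrangement \<gamma> (\<lambda>s. k * indicat_real {0<..<t} s) s \<le> ennreal r" if "0 < r" for r
    unfolding rearrangement_def using that False assms
    by (intro Inf_lower) (auto simp: distribution_fun_indicator ennreal_leI)
  then have "rearrangement \<gamma> (\<lambda>s. k * indicat_real {0<..<t} s) s \<le> 0"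
    by - (rule ennreal_le_epsilon, simp)
  then show ?thesis using False by simp
qed

text \<open>From t on the rearrangement is 0 and \<open>\<phi> 0 = 0\<close>. Equality of the
  integrands is only almost everywhere, because at the point 0 the left one need not vanish.\<close>

lemma modular_integral_indicator:
  assumes Y: "young_function \<phi>" and "0 < k" "0 < t" "ereal t < \<gamma>"
  shows "(\<integral>\<^sup>+s\<in>dom_I \<gamma>. \<phi> (rearrangement \<gamma> (\<lambda>s. k * indicat_real {0<..<t} s) s / ennreal (v s))
        * ennreal (v s) \<partial>lebesgue)
    = (\<integral>\<^sup>+s\<in>{0<..<t}. \<phi> (ennreal k / ennreal (v s)) * ennreal (v s) \<partial>lebesgue)"
proof (rule nn_integral_cong_AE)
  have "{0} \<in> null_sets lebesgue" by simp
  then have "AE s in lebesgue. s \<notin> {0::real}" by (rule AE_not_in)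
  moreover have "ereal x < \<gamma>" if "x < t" for x
    using ereal_less_downward[of x t \<gamma>] that assms by simp
  moreover have "\<phi> 0 = 0" using Y unfolding young_function_def by blast
  ultimately show "AE s in lebesgue. \<phi> (rearrangement \<gamma> (\<lambda>s. k * indicat_real {0<..<t} s) s / ennreal (v s))
        * ennreal (v s) * indicator (dom_I \<gamma>) s
      = \<phi> (ennreal k / ennreal (v s)) * ennreal (v s) * indicator {0<..<t} s"
    using assms rearrangement_indicator[of k t \<gamma>]
    by (elim eventually_mono) (auto simp: dom_I_def indicator_def)
qed

subsection \<open>The modular of an indicator function\<close>

lemma modular_lower_bound:
  assumes Y: "young_function \<phi>" and v: "pos_decreasing \<gamma> v"
    and "0 < k" "0 < t" "ereal t < \<gamma>" "0 < W"
    and V: "(\<integral>\<^sup>+s\<in>{0<..<t}. zero_ext \<gamma> v s \<partial>lebesgue) \<le> ennreal W"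
  shows "ennreal W * \<phi> (ennreal (k * t / W))
    \<le> (\<integral>\<^sup>+s\<in>{0<..<t}. \<phi> (ennreal k / ennreal (v s)) * ennreal (v s) \<partial>lebesgue)" (is "_ \<le> ?J")
proof -
  define u where "u = k * t / W"
  have u: "0 < u" using \<open>0 < k\<close> \<open>0 < t\<close> \<open>0 < W\<close> by (simp add: u_def)
  have vI: "(\<lambda>s. zero_ext \<gamma> v s * indicator {0<..<t} s) \<in> borel_measurable lebesgue"
    by (intro borel_measurable_times_ennreal zero_ext_measurable[OF v] borel_measurable_indicator) simp
  have bound: "ennreal (m * W) \<le> ?J" if m: "0 \<le> m" "ennreal m < \<phi> (ennreal u)" for m
  proof -
    obtain p q where pq: "0 \<le> p" "0 \<le> q" "m \<le> p * u - q"
      "\<And>x. 0 \<le> x \<Longrightarrow> ennreal (p * x) \<le> \<phi> (ennreal x) + ennreal q"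
      using young_minorant[OF Y u m(2,1)] by blast
    \<comment> \<open>Additivity of the integral asks for measurable summands. \<open>F\<close> is a
      measurable minorant of the integrand, built with truncated subtraction, and \<open>G\<close>
      restores what it lost, so that \<open>F\<close> + \<open>G\<close> is at least p k on
      (0,t).\<close>
    define F where "F s = (ennreal (p * k) - ennreal q * zero_ext \<gamma> v s) * indicator {0<..<t} s" for s
    define G where "G s = ennreal q * (zero_ext \<gamma> v s * indicator {0<..<t} s)" for s
    have F_meas: "F \<in> borel_measurable lebesgue"
      unfolding F_def
      by (intro borel_measurable_times_ennreal borel_measurable_minus_ennreal borel_measurable_const
          zero_ext_measurable[OF v] borel_measurable_indicator) simp
    have G_meas: "G \<in> borel_measurable lebesgue"
      unfolding G_def by (intro borel_measurable_times_ennreal borel_measurable_const vI)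
    have F: "F s \<le> \<phi> (ennreal k / ennreal (v s)) * ennreal (v s) * indicator {0<..<t} s" for s
    proof (cases "s \<in> {0<..<t}")
      case True
      then have s: "s \<in> dom_I \<gamma> - {0}"
        using ereal_less_downward[of s t \<gamma>] \<open>ereal t < \<gamma>\<close> by (simp add: dom_I_def)
      then have vs: "0 < v s" using v by (auto simp: pos_decreasing_def)
      have "ennreal (p * k) = ennreal (p * (k / v s)) * ennreal (v s)"
        using vs pq \<open>0 < k\<close> by (simp flip: ennreal_mult)
      also have "\<dots> \<le> (\<phi> (ennreal (k / v s)) + ennreal q) * ennreal (v s)"
        using pq(4)[of "k / v s"] vs \<open>0 < k\<close> by (intro mult_right_mono) auto
      also have "\<dots> = ennreal q * zero_ext \<gamma> v s + \<phi> (ennreal k / ennreal (v s)) * ennreal (v s)"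
        using s vs \<open>0 < k\<close> by (simp add: zero_ext_def divide_ennreal distrib_right add.commute)
      finally show ?thesis using True by (simp add: F_def ennreal_minus_le_iff)
    qed (simp add: F_def)
    have "ennreal (p * k) * indicator {0<..<t} s \<le> F s + G s" for s
    proof -
      have "a \<le> (a - b) + b" for a b :: ennreal
        using ennreal_minus_le_iff[of a b "a - b"] by (simp add: add.commute)
      then show ?thesis by (simp add: F_def G_def indicator_def)
    qed
    then have "(\<integral>\<^sup>+s. ennreal (p * k) * indicator {0<..<t} s \<partial>lebesgue) \<le> (\<integral>\<^sup>+s. F s + G s \<partial>lebesgue)"
      by (rule nn_integral_mono)
    also have "\<dots> = (\<integral>\<^sup>+s. F s \<partial>lebesgue) + (\<integral>\<^sup>+s. G s \<partial>lebesgue)"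
      by (rule nn_integral_add[OF F_meas G_meas])
    also have "\<dots> \<le> ?J + ennreal q * ennreal W"
    proof (rule add_mono)
      show "(\<integral>\<^sup>+s. F s \<partial>lebesgue) \<le> ?J" by (rule nn_integral_mono) (rule F)
      have "(\<integral>\<^sup>+s. G s \<partial>lebesgue) = ennreal q * (\<integral>\<^sup>+s\<in>{0<..<t}. zero_ext \<gamma> v s \<partial>lebesgue)"
        unfolding G_def by (rule nn_integral_cmult[OF vI])
      then show "(\<integral>\<^sup>+s. G s \<partial>lebesgue) \<le> ennreal q * ennreal W"
        using V by (simp add: mult_left_mono)
    qed
    also have "(\<integral>\<^sup>+s. ennreal (p * k) * indicator {0<..<t} s \<partial>lebesgue) = ennreal (p * k * t)"
      using \<open>0 < k\<close> \<open>0 < t\<close> pq by (subst nn_integral_cmult_indicator) (auto simp: ennreal_mult)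
    finally have "ennreal (p * k * t) \<le> ?J + ennreal (q * W)"
      using \<open>0 < W\<close> pq by (simp add: ennreal_mult)
    \<comment> \<open>Here u = k t / W enters: p u W = p k t.\<close>
    moreover have "m * W + q * W \<le> p * k * t"
    proof -
      have "m * W \<le> (p * u - q) * W" using pq \<open>0 < W\<close> by (intro mult_right_mono) auto
      then show ?thesis using \<open>0 < W\<close> by (simp add: u_def left_diff_distrib)
    qed
    ultimately have "ennreal (m * W) + ennreal (q * W) \<le> ?J + ennreal (q * W)"
      using m pq \<open>0 < W\<close> order_trans[OF ennreal_leI] by (simp flip: ennreal_plus)
    then show ?thesis
      using ennreal_add_left_cancel_le[of "ennreal (q * W)"] by (simp add: add.commute)
  qed
  \<comment> \<open>Lets m increase to \<open>\<phi> u\<close>, which may be infinite.\<close>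
  have "\<phi> (ennreal u) \<le> ?J / ennreal W"
  proof (rule dense_le)
    fix z assume z: "z < \<phi> (ennreal u)"
    then obtain m where m: "z = ennreal m" "0 \<le> m" by (cases z) auto
    have "z * ennreal W = ennreal (m * W)" using m \<open>0 < W\<close> by (simp add: ennreal_mult)
    also have "\<dots> \<le> ?J" using bound m z by simp
    finally have "z * ennreal W / ennreal W \<le> ?J / ennreal W" by (rule divide_right_mono_ennreal)
    then show "z \<le> ?J / ennreal W" using \<open>0 < W\<close> by (simp add: ennreal_mult_divide_eq)
  qed
  then have "ennreal W * \<phi> (ennreal u) \<le> ennreal W * (?J / ennreal W)"
    by (rule mult_left_mono) simp
  also have "\<dots> = ?J * ennreal W / ennreal W"
    by (simp only: ennreal_times_divide mult.commute)
  also have "\<dots> = ?J" using \<open>0 < W\<close> by (intro ennreal_mult_divide_eq) auto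
  finally show ?thesis by (simp add: u_def)
qed

section \<open>The primitive of the weight and the level weight\<close>

lemma primitive_ge:
  assumes w: "pos_decreasing \<gamma> w" and s: "0 < s" "ereal s < \<gamma>"
  shows "ennreal (s * w s) \<le> primitive w s"
proof -
  have D: "x \<in> dom_I \<gamma> - {0}" if "0 < x" "x \<le> s" for x
    using that ereal_less_downward[OF _ s(2), of x] by (simp add: dom_I_def)
  have "ennreal (s * w s) = (\<integral>\<^sup>+x. ennreal (w s) * indicator {0<..<s} x \<partial>lebesgue)"
    using s by (subst nn_integral_cmult_indicator) (auto simp: ennreal_mult' mult.commute)
  also have "\<dots> \<le> primitive w s"
    unfolding primitive_def
  proof (rule nn_integral_mono)
    fix x
    have "w s \<le> w x" if "0 < x" "x < s"
      using w D[of x] D[of s] that s by (auto simp: pos_decreasing_def monotone_on_def)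
    then show "ennreal (w s) * indicator {0<..<s} x \<le> ennreal (w x) * indicator {0<..<s} x"
      by (auto simp: indicator_def intro: ennreal_leI)
  qed
  finally show ?thesis .
qed

lemma nn_integral_zero_ext_split:
  assumes w: "pos_decreasing \<gamma> w" and "0 < s" "s \<le> t"
  shows "(\<integral>\<^sup>+x\<in>{0<..<t}. zero_ext \<gamma> w x \<partial>lebesgue) =
    (\<integral>\<^sup>+x\<in>{0<..<s}. zero_ext \<gamma> w x \<partial>lebesgue) + (\<integral>\<^sup>+x\<in>{s..<t}. zero_ext \<gamma> w x \<partial>lebesgue)"
proof -
  have "{0<..<t} = {0<..<s} \<union> {s..<t}" using assms by auto
  then show ?thesis
    using nn_integral_disjoint_pair[OF zero_ext_measurable[OF w], of "{0<..<s}" "{s..<t}"]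
    by (simp add: disjoint_iff)
qed

lemma primitive_le:
  assumes w: "pos_decreasing \<gamma> w" and s: "0 < s" "s \<le> t" "ereal t < \<gamma>"
  shows "primitive w t \<le> primitive w s + ennreal ((t - s) * w s)"
proof -
  have "(\<integral>\<^sup>+x\<in>{s..<t}. zero_ext \<gamma> w x \<partial>lebesgue) \<le> (\<integral>\<^sup>+x. ennreal (w s) * indicator {s..<t} x \<partial>lebesgue)"
  proof (rule nn_integral_mono)
    fix x
    have "w x \<le> w s" if "s \<le> x" "x \<in> dom_I \<gamma>"
    proof -
      have "s \<in> dom_I \<gamma> - {0}" using ereal_less_downward[OF s(2,3)] s by (simp add: dom_I_def)
      then show ?thesis using w that s by (auto simp: pos_decreasing_def monotone_on_def)
    qed
    then show "zero_ext \<gamma> w x * indicator {s..<t} x \<le> ennreal (w s) * indicator {s..<t} x"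
      by (auto simp: zero_ext_def indicator_def intro: ennreal_leI)
  qed
  also have "\<dots> = ennreal ((t - s) * w s)"
    using s by (subst nn_integral_cmult_indicator) (auto simp: ennreal_mult'' mult.commute)
  finally have "(\<integral>\<^sup>+x\<in>{s..<t}. zero_ext \<gamma> w x \<partial>lebesgue) \<le> ennreal ((t - s) * w s)" .
  then have "(\<integral>\<^sup>+x\<in>{0<..<t}. zero_ext \<gamma> w x \<partial>lebesgue)
      \<le> (\<integral>\<^sup>+x\<in>{0<..<s}. zero_ext \<gamma> w x \<partial>lebesgue) + ennreal ((t - s) * w s)"
    unfolding nn_integral_zero_ext_split[OF w s(1,2)] by (rule add_left_mono)
  moreover have "ereal s \<le> \<gamma>" using ereal_less_downward[OF s(2,3)] by (rule less_imp_le)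
  ultimately show ?thesis
    using primitive_eq_zero_ext[of s \<gamma> w] primitive_eq_zero_ext[of t \<gamma> w] s by simp
qed

lemma primitive_weight:
  assumes W: "weight_function \<gamma> w" and t: "0 < t" "ereal t < \<gamma>"
  shows "0 < primitive w t" "primitive w t < \<infinity>"
proof -
  have "t \<in> dom_I \<gamma> - {0}" using t by (simp add: dom_I_def)
  then have "0 < w t" "primitive w t < \<infinity>"
    using W unfolding weight_function_def pos_decreasing_def by blast+
  moreover have "ennreal (t * w t) \<le> primitive w t"
    using W t by (intro primitive_ge) (auto simp: weight_function_def)
  ultimately show "0 < primitive w t" "primitive w t < \<infinity>"
    using t by (auto intro: less_le_trans[of 0 "ennreal (t * w t)"])
qed

text \<open>W(t) / t <= W(s) / s, multiplied out. After s the primitive grows at rate at most w s,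
  and w s is at most the average W(s) / s.\<close>

lemma primitive_concave:
  assumes W: "weight_function \<gamma> w" and s: "0 < s" "s \<le> t" "ereal t < \<gamma>"
  shows "s * enn2real (primitive w t) \<le> t * enn2real (primitive w s)"
proof -
  have w: "pos_decreasing \<gamma> w" using W by (simp add: weight_function_def)
  have s': "ereal s < \<gamma>" using ereal_less_downward[OF s(2,3)] .
  then have "0 < w s" using w s by (simp add: pos_decreasing_def dom_I_def)
  obtain A B where AB: "primitive w s = ennreal A" "primitive w t = ennreal B" "0 \<le> A" "0 \<le> B"
    using primitive_weight[OF W s(1) s'] primitive_weight[OF W _ s(3)] s
    by (cases "primitive w s"; cases "primitive w t") auto
  have A: "s * w s \<le> A" using primitive_ge[OF w s(1) s'] AB by simp
  have "B \<le> A + (t - s) * w s"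
    using primitive_le[OF w s] AB s \<open>0 < w s\<close> by (simp flip: ennreal_plus)
  then have "s * B \<le> s * (A + (t - s) * w s)" using s by (intro mult_left_mono) auto
  also have "\<dots> = s * A + (t - s) * (s * w s)" by (simp add: algebra_simps)
  also have "\<dots> \<le> s * A + (t - s) * A" using A s by (intro add_left_mono mult_left_mono) auto
  also have "\<dots> = t * A" by (simp add: algebra_simps)
  finally show ?thesis using AB by simp
qed

text \<open>The minimiser of the modular of an indicator function: \<open>w\<close> averaged over \<open>(0, t)\<close>.\<close>

lemma level_weight:
  assumes W: "weight_function \<gamma> w" and t: "0 < t" "ereal t < \<gamma>"
  defines "v \<equiv> (\<lambda>s. if s < t then enn2real (primitive w t) / t else w s)"
  shows "pos_decreasing \<gamma> v" "majorized \<gamma> v w"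
proof -
  have w: "pos_decreasing \<gamma> w" using W by (simp add: weight_function_def)
  obtain B where B: "primitive w t = ennreal B" "0 < B"
    using primitive_weight[OF W t] by (cases "primitive w t") auto
  have "t * w t \<le> B" using primitive_ge[OF w t] B by simp
  \<comment> \<open>The average over (0,t) is at least w t, so v does not jump upwards at t.\<close>
  then have wt: "w t \<le> B / t" using t by (simp add: field_simps)
  have tD: "t \<in> dom_I \<gamma> - {0}" using t by (simp add: dom_I_def)
  show v: "pos_decreasing \<gamma> v"
    unfolding pos_decreasing_def
  proof
    show "\<forall>s\<in>dom_I \<gamma> - {0}. 0 < v s"
      using w B t by (auto simp: v_def pos_decreasing_def)
    show "antimono_on (dom_I \<gamma> - {0}) v"
    proof (rule monotone_onI)
      fix x y assume xy: "x \<in> dom_I \<gamma> - {0}" "y \<in> dom_I \<gamma> - {0}" "x \<le> y"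
      have mono: "w b \<le> w a" if "a \<in> dom_I \<gamma> - {0}" "b \<in> dom_I \<gamma> - {0}" "a \<le> b" for a b
        using w that unfolding pos_decreasing_def by (auto dest: monotone_onD)
      show "v y \<le> v x"
        using xy mono[of t y] mono[of x y] wt tD B by (auto simp: v_def)
    qed
  qed
  \<comment> \<open>Up to t the integral of v is the chord r B / t, which lies below the concave
    primitive.\<close>
  have le: "(\<integral>\<^sup>+s\<in>{0<..<r}. zero_ext \<gamma> v s \<partial>lebesgue) \<le> (\<integral>\<^sup>+s\<in>{0<..<r}. zero_ext \<gamma> w s \<partial>lebesgue)"
    if r: "0 < r" "r \<le> t" for r
  proof -
    have r': "ereal r < \<gamma>" using ereal_less_downward[OF r(2) t(2)] .
    obtain A where A: "primitive w r = ennreal A" "0 \<le> A"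
      using primitive_weight[OF W r(1) r'] by (cases "primitive w r") auto
    have "(\<integral>\<^sup>+s\<in>{0<..<r}. zero_ext \<gamma> v s \<partial>lebesgue)
        = (\<integral>\<^sup>+s. ennreal (B / t) * indicator {0<..<r} s \<partial>lebesgue)"
      using r B r' by (intro nn_integral_cong) (auto simp: indicator_def zero_ext_eq[of r] v_def)
    also have "\<dots> = ennreal (B / t) * ennreal r"
      using r by (subst nn_integral_cmult_indicator) auto
    also have "\<dots> = ennreal (r * B / t)" using B t r by (simp add: mult.commute flip: ennreal_mult)
    also have "\<dots> \<le> ennreal A"
      using primitive_concave[OF W r t(2)] A B t by (intro ennreal_leI) (simp add: field_simps)
    also have "\<dots> = (\<integral>\<^sup>+s\<in>{0<..<r}. zero_ext \<gamma> w s \<partial>lebesgue)"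
      using primitive_eq_zero_ext[of r \<gamma> w] r' A by simp
    finally show ?thesis .
  qed
  have "(\<integral>\<^sup>+s\<in>{0<..<r}. zero_ext \<gamma> v s \<partial>lebesgue) \<le> (\<integral>\<^sup>+s\<in>{0<..<r}. zero_ext \<gamma> w s \<partial>lebesgue)"
    if r: "0 < r" for r
  proof (cases "r \<le> t")
    case True
    then show ?thesis using le r by blast
  next
    case False
    then have tr: "t \<le> r" by simp
    \<comment> \<open>Past t both functions coincide, so the comparison at t carries over.\<close>
    have "(\<integral>\<^sup>+x\<in>{t..<r}. zero_ext \<gamma> v x \<partial>lebesgue) = (\<integral>\<^sup>+x\<in>{t..<r}. zero_ext \<gamma> w x \<partial>lebesgue)"
      by (rule nn_integral_cong) (auto simp: indicator_def zero_ext_def v_def)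
    then show ?thesis
      using le[of t] t(1) unfolding nn_integral_zero_ext_split[OF v t(1) tr] nn_integral_zero_ext_split[OF w t(1) tr]
      by (simp add: add_right_mono)
  qed
  then show "majorized \<gamma> v w" using majorized_iff[OF v w] by blast
qed

lemma modular_P_indicator:
  assumes Y: "young_function \<phi>" and W: "weight_function \<gamma> w"
    and t: "0 < t" "ereal t < \<gamma>" and k: "0 < k" and B: "primitive w t = ennreal B"
  shows "modular_P \<gamma> \<phi> w (\<lambda>s. k * indicat_real {0<..<t} s) = ennreal B * \<phi> (ennreal (k * t / B))"
proof (rule antisym)
  have w: "pos_decreasing \<gamma> w" using W by (simp add: weight_function_def)
  have B0: "0 < B" using primitive_weight[OF W t] B by simp
  show "ennreal B * \<phi> (ennreal (k * t / B)) \<le> modular_P \<gamma> \<phi> w (\<lambda>s. k * indicat_real {0<..<t} s)"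
    unfolding modular_P_def
  proof (rule Inf_greatest, safe)
    fix v assume maj: "majorized \<gamma> v w" and v: "pos_decreasing \<gamma> v"
    have "(\<integral>\<^sup>+s\<in>{0<..<t}. zero_ext \<gamma> v s \<partial>lebesgue) \<le> ennreal B"
      using maj t primitive_eq_zero_ext[of t \<gamma> w] unfolding majorized_iff[OF v w] B[symmetric] by simp
    then show "ennreal B * \<phi> (ennreal (k * t / B))
      \<le> (\<integral>\<^sup>+s\<in>dom_I \<gamma>. \<phi> (rearrangement \<gamma> (\<lambda>s. k * indicat_real {0<..<t} s) s / ennreal (v s))
          * ennreal (v s) \<partial>lebesgue)"
      unfolding modular_integral_indicator[OF Y k t] by (rule modular_lower_bound[OF Y v k t B0])
  qed
  define v where "v = (\<lambda>s. if s < t then enn2real (primitive w t) / t else w s)"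
  have v: "pos_decreasing \<gamma> v" "majorized \<gamma> v w"
    using level_weight[OF W t] by (simp_all add: v_def)
  have "modular_P \<gamma> \<phi> w (\<lambda>s. k * indicat_real {0<..<t} s)
    \<le> (\<integral>\<^sup>+s\<in>dom_I \<gamma>. \<phi> (rearrangement \<gamma> (\<lambda>s. k * indicat_real {0<..<t} s) s / ennreal (v s))
          * ennreal (v s) \<partial>lebesgue)"
    unfolding modular_P_def using v by (intro Inf_lower) blast
  also have "\<dots> = (\<integral>\<^sup>+s\<in>{0<..<t}. \<phi> (ennreal k / ennreal (v s)) * ennreal (v s) \<partial>lebesgue)"
    by (rule modular_integral_indicator[OF Y k t])
  \<comment> \<open>On (0,t), v = B / t, so k / v is the constant k t / B and the lower bound is
    attained.\<close>
  also have "\<dots> = (\<integral>\<^sup>+s. (\<phi> (ennreal (k * t / B)) * ennreal (B / t)) * indicator {0<..<t} s \<partial>lebesgue)"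
    using B B0 t k by (intro nn_integral_cong) (auto simp: indicator_def v_def divide_ennreal)
  also have "\<dots> = \<phi> (ennreal (k * t / B)) * ennreal (B / t) * ennreal t"
    using t by (subst nn_integral_cmult_indicator) auto
  also have "\<dots> = ennreal B * \<phi> (ennreal (k * t / B))"
  proof -
    have "ennreal (B / t) * ennreal t = ennreal B" using t B0 by (simp flip: ennreal_mult)
    then show ?thesis by (metis mult.assoc mult.commute)
  qed
  finally show "modular_P \<gamma> \<phi> w (\<lambda>s. k * indicat_real {0<..<t} s) \<le> ennreal B * \<phi> (ennreal (k * t / B))" .
qed

theorem theorem2p3:
  fixes \<gamma> :: ereal and w :: "real \<Rightarrow> real" and \<phi> :: "ennreal \<Rightarrow> ennreal" and t :: real
  assumes "0 < \<gamma>"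
    and "weight_function \<gamma> w"
    and "young_function \<phi>"
    and "0 < t" and "ereal t < \<gamma>"
  shows "indicat_real {0<..<t} \<in> M_space \<gamma> \<phi> w \<and>
    M_fundamental \<gamma> \<phi> w t
      = (ennreal t / primitive w t) / young_inverse \<phi> (1 / primitive w t)"
proof -
  note W = assms(2) and Y = assms(3) and t = assms(4,5)
  obtain B where B: "primitive w t = ennreal B" "0 < B"
    using primitive_weight[OF W t] by (cases "primitive w t") auto
  have inv: "1 / primitive w t = ennreal (1 / B)"
    using B divide_ennreal[of 1 B] by simp
  obtain y where y: "young_inverse \<phi> (1 / primitive w t) = ennreal y" "0 < y"
    using young_inverse_sublevel(1,2)[OF Y, of "ennreal (1 / B)"] B
    unfolding inv by (cases "young_inverse \<phi> (ennreal (1 / B))") auto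
  have modular_le: "modular_P \<gamma> \<phi> w (\<lambda>s. k * indicat_real {0<..<t} s) \<le> 1 \<longleftrightarrow> k * t / B \<le> y"
    if k: "0 < k" for k
  proof -
    have "modular_P \<gamma> \<phi> w (\<lambda>s. k * indicat_real {0<..<t} s) \<le> 1
        \<longleftrightarrow> ennreal B * \<phi> (ennreal (k * t / B)) \<le> ennreal B * ennreal (1 / B)"
      using B by (simp add: modular_P_indicator[OF Y W t k B(1)] flip: ennreal_mult)
    also have "\<dots> \<longleftrightarrow> \<phi> (ennreal (k * t / B)) \<le> ennreal (1 / B)"
      using B by (intro ennreal_mult_le_mult_iff) auto
    also have "\<dots> \<longleftrightarrow> ennreal (k * t / B) \<le> ennreal y"
      using young_inverse_sublevel(3)[OF Y, of "ennreal (1 / B)" "ennreal (k * t / B)"] B y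
      unfolding inv by simp
    also have "\<dots> \<longleftrightarrow> k * t / B \<le> y" using y by simp
    finally show ?thesis .
  qed
  have "indicat_real {0<..<t} \<in> M_space \<gamma> \<phi> w"
  proof -
    have "indicat_real {0<..<t} \<in> borel_measurable (lebesgue_on (dom_I \<gamma>))"
      by (intro measurable_restrict_space1 borel_measurable_indicator) simp
    \<comment> \<open>The largest k for which the modular is at most 1.\<close>
    moreover have "modular_P \<gamma> \<phi> w (\<lambda>s. (y * B / t) * indicat_real {0<..<t} s) \<le> 1"
      using modular_le[of "y * B / t"] y B t by simp
    then have "modular_P \<gamma> \<phi> w (\<lambda>s. (y * B / t) * indicat_real {0<..<t} s) < \<infinity>"
      by (rule le_less_trans) simp
    moreover have "0 < y * B / t" using y B t by simp
    ultimately show ?thesis unfolding M_space_def by blast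
  qed
  moreover have "M_fundamental \<gamma> \<phi> w t = ennreal (t / B / y)"
  proof -
    have "modular_P \<gamma> \<phi> w (\<lambda>s. indicat_real {0<..<t} s / e) \<le> 1 \<longleftrightarrow> t / B / y \<le> e" if "0 < e" for e
    proof -
      \<comment> \<open>Take k = 1 / e: then t / (e B) <= y turns into a lower bound on e, whose
        least value is the norm.\<close>
      have "(\<lambda>s. indicat_real {0<..<t} s / e) = (\<lambda>s. (1 / e) * indicat_real {0<..<t} s)" by auto
      then have "modular_P \<gamma> \<phi> w (\<lambda>s. indicat_real {0<..<t} s / e) \<le> 1 \<longleftrightarrow> 1 / e * t / B \<le> y"
        using modular_le[of "1 / e"] that by simp
      then show ?thesis using that B y by (simp add: field_simps)
    qed
    then have "{ennreal e | e. 0 < e \<and> modular_P \<gamma> \<phi> w (\<lambda>s. indicat_real {0<..<t} s / e) \<le> 1}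
        = {ennreal e | e. 0 < e \<and> t / B / y \<le> e}" by (metis (no_types, lifting))
    moreover have "Inf {ennreal e | e. 0 < e \<and> t / B / y \<le> e} = ennreal (t / B / y)"
    proof (rule antisym)
      have "0 < t / B / y" using t B y by simp
      then show "Inf {ennreal e | e. 0 < e \<and> t / B / y \<le> e} \<le> ennreal (t / B / y)"
        by (intro Inf_lower) blast
      show "ennreal (t / B / y) \<le> Inf {ennreal e | e. 0 < e \<and> t / B / y \<le> e}"
        by (rule Inf_greatest) (auto intro: ennreal_leI)
    qed
    ultimately show ?thesis by (simp add: M_fundamental_def M_norm_def)
  qed
  moreover have "ennreal t / primitive w t / young_inverse \<phi> (1 / primitive w t) = ennreal (t / B / y)"
    unfolding y B(1) using t B y by (simp add: divide_ennreal)
  ultimately show ?thesis by simp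
qed

end
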